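(* Let $\mathbf{A} \in \mathsf{CIdInRL}$. Then $\{ 0_x \mid x \in A \} = \{ x \in A \mid x \leq 0 \}$ and $\{ 1_x \mid x \in A \} = A^+$. The algebra $\langle \{ 0_x \mid x \in A \}, \cdot, \vee, 0 \rangle$ (with meet $\cdot$ and join $\vee$) is a distributive sublattice of the lattice $\langle A,\wedge,\vee\rangle$ with maximum element $0$, and it is dually isomorphic to $\langle A^+,\wedge, \vee, 1\rangle = \langle A^+, \wedge, \cdot, 1 \rangle$.
   Context: A commutative idempotent involutive residuated lattice is an algebra $\mathbf{A}=\langle A,\wedge,\vee,\cdot,\to,1,0\rangle$ such that $\langle A,\wedge,\vee\rangle$ is a lattice (with lattice order $\leq$), $\langle A,\cdot,1\rangle$ is a commutative monoid with $x\cdot x=x$ for all $x$, residuation holds ($x\cdot y\leq z \iff y\leq x\to z$), and, writing $-x := x\to 0$, one has $-{-}x=x$ for all $x$. The class of these algebras is $\mathsf{CIdInRL}$. For $x\in A$ put $1_x := x\vee -x$ and $0_x := x\wedge -x$. The positive cone is $A^+ := \{x\in A\mid 1\leq x\}$. *)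

theory Defs
  imports Main
begin

class cid_in_rl = lattice + comm_monoid_mult + zero +
  fixes residual :: "'a \<Rightarrow> 'a \<Rightarrow> 'a"  (infixr "\<leadsto>" 60)
  assumes mult_idem: "x * x = x"
    and residuation: "x * y \<le> z \<longleftrightarrow> y \<le> x \<leadsto> z"
    and involutive: "(x \<leadsto> 0) \<leadsto> 0 = x"
begin

definition neg :: "'a \<Rightarrow> 'a" where
  "neg x = x \<leadsto> 0"

text \<open>The elements written $1_x$ and $0_x$.\<close>

definition local_one :: "'a \<Rightarrow> 'a" where
  "local_one x = sup x (neg x)"

definition local_zero :: "'a \<Rightarrow> 'a" where
  "local_zero x = inf x (neg x)"

definition positive_cone :: "'a set" where
  "positive_cone = {x. 1 \<le> x}"

end

text \<open>Lattices as algebras with an explicit carrier. In each definition the arguments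
  are the carrier, the meet and the join, in this order, followed by the distinguished
  element for pointed lattices.\<close>

definition lattice_on :: "'a set \<Rightarrow> ('a \<Rightarrow> 'a \<Rightarrow> 'a) \<Rightarrow> ('a \<Rightarrow> 'a \<Rightarrow> 'a) \<Rightarrow> bool" where
  "lattice_on S m j \<longleftrightarrow>
     (\<forall>x\<in>S. \<forall>y\<in>S. m x y \<in> S \<and> j x y \<in> S) \<and>
     (\<forall>x\<in>S. \<forall>y\<in>S. m x y = m y x \<and> j x y = j y x) \<and>
     (\<forall>x\<in>S. \<forall>y\<in>S. \<forall>z\<in>S. m (m x y) z = m x (m y z) \<and> j (j x y) z = j x (j y z)) \<and>
     (\<forall>x\<in>S. \<forall>y\<in>S. m x (j x y) = x \<and> j x (m x y) = x)"

definition distributive_lattice_on ::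
  "'a set \<Rightarrow> ('a \<Rightarrow> 'a \<Rightarrow> 'a) \<Rightarrow> ('a \<Rightarrow> 'a \<Rightarrow> 'a) \<Rightarrow> bool" where
  "distributive_lattice_on S m j \<longleftrightarrow>
     lattice_on S m j \<and>
     (\<forall>x\<in>S. \<forall>y\<in>S. \<forall>z\<in>S. m x (j y z) = j (m x y) (m x z))"

text \<open>The operations of a sublattice are the restrictions of those of the ambient
  lattice, so this forces \<open>m\<close> and \<open>j\<close> to agree with \<open>inf\<close> and \<open>sup\<close> on \<open>S\<close>.\<close>

definition sublattice ::
  "'a::lattice set \<Rightarrow> ('a \<Rightarrow> 'a \<Rightarrow> 'a) \<Rightarrow> ('a \<Rightarrow> 'a \<Rightarrow> 'a) \<Rightarrow> bool" where
  "sublattice S m j \<longleftrightarrow>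
     S \<noteq> {} \<and>
     (\<forall>x\<in>S. \<forall>y\<in>S. inf x y \<in> S \<and> sup x y \<in> S) \<and>
     (\<forall>x\<in>S. \<forall>y\<in>S. m x y = inf x y \<and> j x y = sup x y)"

definition pointed_lattice_on ::
  "'a set \<Rightarrow> ('a \<Rightarrow> 'a \<Rightarrow> 'a) \<Rightarrow> ('a \<Rightarrow> 'a \<Rightarrow> 'a) \<Rightarrow> 'a \<Rightarrow> bool" where
  "pointed_lattice_on S m j e \<longleftrightarrow> lattice_on S m j \<and> e \<in> S"

definition dually_isomorphic ::
  "'a set \<Rightarrow> ('a \<Rightarrow> 'a \<Rightarrow> 'a) \<Rightarrow> ('a \<Rightarrow> 'a \<Rightarrow> 'a) \<Rightarrow> 'a \<Rightarrow>
   'b set \<Rightarrow> ('b \<Rightarrow> 'b \<Rightarrow> 'b) \<Rightarrow> ('b \<Rightarrow> 'b \<Rightarrow> 'b) \<Rightarrow> 'b \<Rightarrow> bool" where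
  "dually_isomorphic S m j e S' m' j' e' \<longleftrightarrow>
     pointed_lattice_on S m j e \<and> pointed_lattice_on S' m' j' e' \<and>
     (\<exists>f. bij_betw f S S' \<and>
       (\<forall>x\<in>S. \<forall>y\<in>S. f (m x y) = j' (f x) (f y) \<and> f (j x y) = m' (f x) (f y)) \<and>
       f e = e')"

end

(* An element z satisfies z \<le> 0 iff z * z \<le> 0 iff z \<le> -z, that is, iff z equals its own local
   zero; conversely z = inf x (-x) gives z = z * z \<le> x * (-x) \<le> 0. In particular 0 \<le> -0 = 1, so
   below 0 the product lies below both factors, and by idempotence it is the meet. Distributivity is
   that of the product over joins, and the antitone involution - maps the elements below 0 onto the
   positive cone. *)
theory Submission
  imports Defs
begin

context cid_in_rl
begin

lemma mult_left_mono_le: "y \<le> z \<Longrightarrow> x * y \<le> x * z"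
  using residuation order_trans order_refl by metis

lemma mult_mono_le: "a \<le> b \<Longrightarrow> c \<le> d \<Longrightarrow> a * c \<le> b * d"
  by (metis mult_left_mono_le mult.commute order_trans)

text \<open>Residuation makes multiplication by \<open>x\<close> a left adjoint, so it preserves
  joins: the upper bound is moved across the adjunction, split at the join, and moved back.\<close>

lemma mult_sup_distrib: "x * sup y z = sup (x * y) (x * z)"
proof (rule order.antisym)
  show "x * sup y z \<le> sup (x * y) (x * z)"
    by (simp add: residuation) (simp flip: residuation)
qed (simp add: mult_left_mono_le)

lemma neg_neg [simp]: "neg (neg x) = x"
  by (simp add: neg_def involutive)

lemma le_neg_iff: "y \<le> neg x \<longleftrightarrow> x * y \<le> 0"
  by (simp add: neg_def residuation)

text \<open>By commutativity both sides bound the same product by \<open>0\<close>. Thus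
  \<open>neg\<close> forms a Galois connection with itself; being involutive, it is an order
  anti-automorphism, whence the De Morgan laws.\<close>

lemma le_neg_commute: "y \<le> neg x \<longleftrightarrow> x \<le> neg y"
  by (simp add: le_neg_iff mult.commute)

lemma neg_le_neg_iff [simp]: "neg x \<le> neg y \<longleftrightarrow> y \<le> x"
  using le_neg_commute [of "neg x" y] by simp

lemma neg_sup: "neg (sup x y) = inf (neg x) (neg y)"
proof (rule order.antisym)
  have "x \<le> neg (inf (neg x) (neg y))" "y \<le> neg (inf (neg x) (neg y))"
    by (simp_all only: le_neg_commute [of x] le_neg_commute [of y] inf_le1 inf_le2)
  then have "sup x y \<le> neg (inf (neg x) (neg y))"
    by simp
  then show "inf (neg x) (neg y) \<le> neg (sup x y)"
    by (simp only: le_neg_commute [of "sup x y"])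
qed simp

lemma neg_inf: "neg (inf x y) = sup (neg x) (neg y)"
  using neg_sup [of "neg x" "neg y"] by (metis neg_neg)

lemma neg_one [simp]: "neg 1 = 0"
proof (rule order.antisym)
  show "neg 1 \<le> 0"
    using le_neg_iff [of "neg 1" 1] by simp
  show "0 \<le> neg 1"
    by (simp add: le_neg_iff)
qed

lemma neg_zero [simp]: "neg 0 = 1"
  using neg_neg [of 1] by simp

lemma zero_le_one: "0 \<le> 1"
  using le_neg_iff [of 0 0] by (simp add: mult_idem)

lemma neg_le_zero_iff: "neg x \<le> 0 \<longleftrightarrow> 1 \<le> x"
  using neg_le_neg_iff [of x 1] by simp

lemma one_le_neg_iff: "1 \<le> neg x \<longleftrightarrow> x \<le> 0"
  using neg_le_neg_iff [of 0 x] by simp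

lemma local_zero_le_zero: "local_zero x \<le> 0"
proof -
  have "local_zero x * local_zero x \<le> x * neg x"
    unfolding local_zero_def by (rule mult_mono_le) simp_all
  also have "\<dots> \<le> 0"
    by (simp flip: le_neg_iff)
  finally show ?thesis
    by (simp add: mult_idem)
qed

lemma local_zero_eq_self: "x \<le> 0 \<Longrightarrow> local_zero x = x"
  unfolding local_zero_def by (rule inf_absorb1) (simp add: le_neg_iff mult_idem)

lemma range_local_zero: "range local_zero = {x. x \<le> 0}"
  using local_zero_le_zero by (force intro: local_zero_eq_self [symmetric])

text \<open>De Morgan and involutivity; this transfers the description of the local zeros to the
  local ones.\<close>

lemma local_one_eq_neg_local_zero: "local_one x = neg (local_zero x)"
  by (simp add: local_one_def local_zero_def neg_inf sup_commute)

lemma bij_betw_neg_positive_cone: "bij_betw neg {x. x \<le> 0} positive_cone"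
  by (rule bij_betw_byWitness [where f' = neg])
    (auto simp: positive_cone_def neg_le_zero_iff one_le_neg_iff)

lemma range_local_one: "range local_one = positive_cone"
proof -
  have "range local_one = neg ` range local_zero"
    by (simp add: image_image local_one_eq_neg_local_zero)
  then show ?thesis
    using bij_betw_neg_positive_cone by (simp add: range_local_zero bij_betw_def)
qed

text \<open>A factor below \<open>1\<close> can only decrease a product; conversely, the meet is its
  own square, which lies below \<open>x * y\<close> by monotonicity. The bound \<open>1\<close> also
  covers the elements below \<open>0\<close>.\<close>

lemma mult_eq_inf_if_le_one:
  assumes "x \<le> 1" "y \<le> 1"
  shows "x * y = inf x y"
proof (rule order.antisym)
  show "x * y \<le> inf x y"
    using mult_left_mono_le [OF assms(2), of x] mult_left_mono_le [OF assms(1), of y]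
    by (simp add: mult.commute)
  show "inf x y \<le> x * y"
    using mult_mono_le [of "inf x y" x "inf x y" y] by (simp add: mult_idem)
qed

lemma mult_eq_sup_if_one_le:
  assumes "1 \<le> x" "1 \<le> y"
  shows "x * y = sup x y"
proof (rule order.antisym)
  show "x * y \<le> sup x y"
    using mult_mono_le [of x "sup x y" y "sup x y"] by (simp add: mult_idem)
  show "sup x y \<le> x * y"
    using mult_left_mono_le [OF assms(2), of x] mult_left_mono_le [OF assms(1), of y]
    by (simp add: mult.commute)
qed

end

text \<open>The identities are inherited from the ambient lattice, since \<open>m\<close> and
  \<open>j\<close> agree with \<open>inf\<close> and \<open>sup\<close> on the closed set
  \<open>S\<close>.\<close>

lemma sublattice_imp_lattice_on:
  assumes "sublattice S m j"
  shows "lattice_on S m j"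
  using assms unfolding sublattice_def lattice_on_def
  by (auto simp: ac_simps inf_sup_absorb sup_inf_absorb)

theorem theorem3p5:
  fixes A0 Apos :: "'a::cid_in_rl set"
  assumes A0: "A0 = {local_zero x |x. True}"
    and Apos: "Apos = positive_cone"
  shows "A0 = {x. x \<le> 0}
    \<and> {local_one x |x. True} = Apos
    \<and> distributive_lattice_on A0 (*) sup
    \<and> sublattice A0 (*) sup
    \<and> 0 \<in> A0 \<and> (\<forall>x\<in>A0. x \<le> 0)
    \<and> (\<forall>x\<in>Apos. \<forall>y\<in>Apos. sup x y = x * y)
    \<and> dually_isomorphic A0 (*) sup 0 Apos inf sup 1"
proof -
  have A0_eq: "A0 = {x. x \<le> 0}"
    using range_local_zero by (simp add: A0 full_SetCompr_eq)
  have Apos_eq: "{local_one x |x. True} = Apos"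
    using range_local_one by (simp add: Apos full_SetCompr_eq)
  have mult_eq_inf: "x * y = inf x y" if "x \<in> A0" "y \<in> A0" for x y
    using that zero_le_one by (auto simp: A0_eq intro!: mult_eq_inf_if_le_one intro: order_trans)
  have sub_A0: "sublattice A0 (*) sup"
    \<comment> \<open>Products become meets while membership in \<open>A0\<close> is still folded,
      as \<open>mult_eq_inf\<close> requires; only then is \<open>A0\<close> unfolded.\<close>
    unfolding sublattice_def by (auto simp: mult_eq_inf) (auto simp: A0_eq intro: le_infI1)
  have sub_Apos: "sublattice Apos inf sup"
    unfolding sublattice_def by (auto simp: Apos positive_cone_def intro: le_supI1)
  have distrib: "distributive_lattice_on A0 (*) sup"
    using sublattice_imp_lattice_on [OF sub_A0]
    by (simp add: distributive_lattice_on_def mult_sup_distrib)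
  have "bij_betw neg A0 Apos"
    unfolding A0_eq Apos by (rule bij_betw_neg_positive_cone)
  \<comment> \<open>The dual isomorphism is \<open>neg\<close>: on \<open>A0\<close> the product is
    the meet, so De Morgan applies to both operations.\<close>
  then have "bij_betw neg A0 Apos \<and>
      (\<forall>x\<in>A0. \<forall>y\<in>A0. neg (x * y) = sup (neg x) (neg y) \<and> neg (sup x y) = inf (neg x) (neg y)) \<and>
      neg 0 = (1::'a)"
    by (simp add: mult_eq_inf neg_inf neg_sup)
  then have dual: "dually_isomorphic A0 (*) sup 0 Apos inf sup 1"
    unfolding dually_isomorphic_def pointed_lattice_on_def
    using sublattice_imp_lattice_on [OF sub_A0] sublattice_imp_lattice_on [OF sub_Apos]
    by (auto simp: A0_eq Apos positive_cone_def)
  have "\<forall>x\<in>Apos. \<forall>y\<in>Apos. sup x y = x * y"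
    by (simp add: Apos positive_cone_def mult_eq_sup_if_one_le)
  then show ?thesis
    using A0_eq Apos_eq distrib sub_A0 dual by simp
qed

end
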